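(* Let $m\le n$ be integers and let $\{M\}_{m,n}=\{M_i\}_{i\in\mathbb Z}$ be a sequence in $\mathbb C[h]$ with $M_i-M_j\in\mathbb Z_+$ for all $i<j$ and with $M_{m-k}=M_m$, $M_{n+k}=M_n$ for all $k\in\mathbb N$. Let $V=V(\{M\}_{m,n};\xi_0,\xi_1)$ with $\xi_0=M_m$, $\xi_1=M_n$. Let $v=\sum_{k\in\mathbb Z_+}h^kv_k$ with $v_k\in\hat V(\{M\}_{m,n};M_m,M_n)$ be an arbitrary element of $V$. Then for each $k\in\mathbb Z_+$ there is an integer $N_k>1$ with $v_k\in V_{N_k}$, and, with $r_{N_k}=\max\{\tfrac12(N_k+3),1-m,n\}$, the following hold: 1. $\rho(U_h(n_+)_\beta)v_k=0$ for every $\beta\in Q_+'$ with $S(\beta)\not\subset(-r_{N_k};r_{N_k})$; 2. $\rho(U_h(n_-)_{-\alpha})v_k=0$ for every nonzero $\alpha\in Q_+'$ with $S(\alpha)\subset(-\infty;-r_{N_k}]$ or $S(\alpha)\subset[r_{N_k};\infty)$; 3. $\rho(h_i)v_k=0$ for every $i\in\mathbb Z$ with $|i|\ge r_{N_k}$. (That is, the representation $\rho$ of $U_h(A_\infty)$ in $V$ is restricted.)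
   Context: Notation. $\mathbb N$ = positive integers, $\mathbb Z_+$ = non-negative integers; $[a;b]=\{x\in\mathbb Z: a\le x\le b\}$, $(a;b)=\{x\in\mathbb Z:a<x<b\}$, and similarly for half-infinite integer intervals; $\theta(i)=1$ for $i\ge0$ and $\theta(i)=0$ for $i<0$; $q=e^{h/2}\in\mathbb C[[h]]$; a bracket with one argument is $[x]=\frac{q^x-q^{-x}}{q-q^{-1}}$; $[x,y]=xy-yx$. Algebra. $U_h(a_\infty)$ is the unital associative $\mathbb C[[h]]$-algebra, complete in the $h$-adic topology and topologically free over $\mathbb C[[h]]$, topologically generated by $\{e_i,f_i,h_i,c\}_{i\in\mathbb Z}$ with relations: $c$ is central; $[h_i,h_j]=0$; $[h_i,e_j]=(\delta_{ij}-\delta_{i,j+1})e_j$; $[h_i,f_j]=-(\delta_{ij}-\delta_{i,j+1})f_j$; $[e_i,f_i]=\big[h_i-h_{i+1}+(\theta(-i)-\theta(-i-1))c\big]$ (one-argument bracket on the right); $[e_i,f_j]=0$ for $i\ne j$; $[e_i,e_j]=[f_i,f_j]=0$ if $|i-j|\ne1$; $x_i^2x_{i\pm1}-(q+q^{-1})x_ix_{i\pm1}x_i+x_{i\pm1}x_i^2=0$ for $x=e$ and $x=f$. It is a subalgebra of the Levendorskii–Soibelman algebra $U_h(A_\infty)$. Let $H=\oplus_i\mathbb Ch_i$, $\varepsilon_i(h_j)=\delta_{ij}$, $\alpha_i=\varepsilon_i-\varepsilon_{i+1}$, $Q_+'=\oplus_i\mathbb Z_+\alpha_i$; for $\alpha=\sum_im_i\alpha_i\in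 Q'_+$ let $S(\alpha)=\{i:m_i\ne0\}$. $U_h(n_+)$ (resp. $U_h(n_-)$) is the unital subalgebra generated by all $e_i$ (resp. $f_i$); $U_h(n_\pm)_{\pm\alpha}=\{x\in U_h(n_\pm):[h',x]=\pm\alpha(h')x\ \forall h'\in H\}$ for $\alpha\ne0$, and $U_h(n_\pm)_0=\mathbb C[[h]]$. $C$-patterns. A $C$-pattern $|M)$ of signature $\{M\}$ is a collection of polynomials $M_{i,2k+\theta-1}\in\mathbb C[h]$ ($k\in\mathbb N$, $\theta\in\{0,1\}$, $i\in[1-\theta-k;k-1]$; the second index numbers the rows) such that: (i) there is an integer $N_{|M)}>1$ with $M_{i,2k+\theta-1}=M_i$ whenever $2k+\theta-1\ge N_{|M)}$ and $i\in[1-\theta-k;k-1]$; (ii) for all $k\in\mathbb N$, $\theta\in\{0,1\}$, $i\in[1-\theta-k;k-1]$: $M_{i+\theta-1,2k+\theta}-M_{i,2k+\theta-1}\in\mathbb Z_+$ and $M_{i,2k+\theta-1}-M_{i+\theta,2k+\theta}\in\mathbb Z_+$. Let $\Gamma(\{M\})$ be the set of all such patterns. $V(\{M\};\xi_0,\xi_1)$ is the $h$-adic completion of the free $\mathbb C[[h]]$-module $\hat V(\{M\};\xi_0,\xi_1)$ with basis $\Gamma(\{M\})$. For an integer $N>1$, $V_N$ is the $\mathbb C[[h]]$-linear span of all $C$-basis vectors $|M)$ with $M_{i,2k+\theta-1}=M_i$ for all rows $2k+\theta-1\ge N$ and all $i\in[1-\theta-k;k-1]$. Action. Put $L_{ij}=M_{ij}-i$;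 $S(j,l;\nu)=(-1)^\nu$ if $j=l$, $1$ if $j<l$, $-1$ if $j>l$; $e_i^0=f_i$, $e_i^1=e_i$. $|M)_{\epsilon_1\{j_1,p_1\},\epsilon_2\{j_2,p_2\}}$ (with $\epsilon_i=\pm1$) denotes the array obtained from $|M)$ by replacing $M_{j_1,p_1}\to M_{j_1,p_1}+\epsilon_1$, $M_{j_2,p_2}\to M_{j_2,p_2}+\epsilon_2$. All bracket arguments below are integers, $|[n]|$ means $[|n|]$ (extended multiplicatively to products and quotients), and square roots are those with positive constant term (and $0^{1/2}=0$). Empty products are $1$. On each $|M)\in\Gamma(\{M\})$: $\rho(e_{-1}^{1-\mu})|M)=\big([L_{-1,2}-L_{0,1}-\mu][L_{0,1}-L_{0,2}+\mu]\big)^{1/2}|M)_{-(-1)^\mu\{0,1\}}$, $\mu=0,1$; for $i\in\mathbb N$, $\mu,\nu\in\{0,1\}$: $$\rho(e^{\mu}_{(-1)^\nu i-1})|M)=-\sum_{j=1-i-\nu}^{i-1}\ \sum_{l=-i}^{i+\nu-1}S(j,l;\nu)\,|X_{j,l}Y_{j,l}|^{1/2}\,|M)_{-(-1)^{\mu+\nu}\{j,2i+\nu-1\},\,-(-1)^{\mu+\nu}\{l,2i+\nu\}},$$ $$X_{j,l}=\frac{\prod_{r\ne l,\,r=-i}^{i+\nu-1}[L_{r,2i+\nu}-L_{j,2i+\nu-1}-(-1)^\nu\mu]\ \prod_{r=1-i}^{i+\nu-2}[L_{r,2i+\nu-2}-L_{j,2i+\nu-1}-(-1)^\nu\mu]}{\prod_{r\ne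 j,\,r=1-i-\nu}^{i-1}[L_{r,2i+\nu-1}-L_{j,2i+\nu-1}]\,[L_{r,2i+\nu-1}-L_{j,2i+\nu-1}+(-1)^{\mu+\nu}]},$$ $$Y_{j,l}=\frac{\prod_{r=-i-\nu}^{i}[L_{r,2i+\nu+1}-L_{l,2i+\nu}+(-1)^\nu(1-\mu)]\ \prod_{r\ne j,\,r=1-i-\nu}^{i-1}[L_{r,2i+\nu-1}-L_{l,2i+\nu}+(-1)^\nu(1-\mu)]}{\prod_{r\ne l,\,r=-i}^{i+\nu-1}[L_{r,2i+\nu}-L_{l,2i+\nu}]\,[L_{r,2i+\nu}-L_{l,2i+\nu}+(-1)^{\mu+\nu}]};$$ for $i\in\mathbb Z$: $\rho(h_i)|M)=\Big(\sum_{j=-|i|}^{|i|+\theta(i)-1}M_{j,2|i|+\theta(i)}-\sum_{j=-|i|+1-\theta(i)}^{|i|-1}M_{j,2|i|+\theta(i)-1}+(\xi_1-\xi_0)\theta(-i)-\xi_1\Big)|M)$; and $\rho(c)|M)=(\xi_0-\xi_1)|M)$. In these formulas every term whose array on the right-hand side is not a $C$-pattern in $\Gamma(\{M\})$ is deleted. $\rho$ is extended to a representation of $U_h(a_\infty)$ in $V$ (multiplicatively, $\mathbb C[[h]]$-linearly and continuously), and further to $U_h(A_\infty)$. "Restricted" is a notion of Levendorskii and Soibelman; for these modules it amounts to properties 1–3. *)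

theory Defs
  imports
    "HOL-Library.Poly_Mapping"
    "HOL-Library.Function_Algebras"
    "HOL-Computational_Algebra.Computational_Algebra"
begin

section \<open>Scalars\<close>

text \<open>The ring of formal power series in \<open>h\<close> over the complex numbers is
  \<^typ>\<open>complex fps\<close>, with \<open>h\<close> being \<^const>\<open>fps_X\<close>.\<close>

definition theta :: "int \<Rightarrow> int"
  where "theta i = (if 0 \<le> i then 1 else 0)"

definition q :: "complex fps"
  where "q = fps_exp (1 / 2)"

text \<open>Numerator and denominator have the same subdegree 1 (for \<open>n \<noteq> 0\<close>), so the
  division of \<^typ>\<open>complex fps\<close> is exact here.\<close>

definition qbracket :: "int \<Rightarrow> complex fps"
  where "qbracket n = (q powi n - q powi (- n)) / (q - inverse q)"

definition pos_sqrt :: "complex fps \<Rightarrow> complex fps"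
  where "pos_sqrt a =
    (if a = 0 then 0
     else (THE b. b ^ 2 = a \<and> (\<exists>r::real. 0 < r \<and> fps_nth b 0 = complex_of_real r)))"


section \<open>The algebra \<open>U\<^sub>h(a\<^sub>\<infinity>)\<close>\<close>

datatype gen = Gen_e int | Gen_f int | Gen_h int | Gen_c

text \<open>Words in the generators, as an additively written non-commutative monoid, so that
  \<open>gword \<Rightarrow>\<^sub>0 complex\<close> is the free associative algebra on the generators.\<close>

datatype gword = Word (letters: "gen list")

instantiation gword :: monoid_add
begin
definition zero_gword :: gword where "0 = Word []"
definition plus_gword :: "gword \<Rightarrow> gword \<Rightarrow> gword"
  where "v + w = Word (letters v @ letters w)"
instance by standard (simp_all add: zero_gword_def plus_gword_def)
end

text \<open>Power series in \<open>h\<close> over the free algebra form the \<open>h\<close>-adically complete free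
  algebra over \<^typ>\<open>complex fps\<close>.\<close>

type_synonym free_alg = "(gword \<Rightarrow>\<^sub>0 complex) fps"

definition scal :: "complex fps \<Rightarrow> free_alg"
  where "scal a = Abs_fps (\<lambda>n. Poly_Mapping.single 0 (fps_nth a n))"

definition letter :: "gen \<Rightarrow> gword \<Rightarrow>\<^sub>0 complex"
  where "letter g = Poly_Mapping.single (Word [g]) 1"

definition fgen :: "gen \<Rightarrow> free_alg"
  where "fgen g = fps_const (letter g)"

definition qexp :: "(gword \<Rightarrow>\<^sub>0 complex) \<Rightarrow> free_alg"
  \<comment> \<open>\<open>q\<^sup>x = exp (h x / 2)\<close>\<close>
  where "qexp x = Abs_fps (\<lambda>n. Poly_Mapping.single 0 (1 / (2 ^ n * fact n)) * x ^ n)"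

text \<open>The bracket \<open>(q\<^sup>x - q\<^sup>-\<^sup>x) / (q - q\<^sup>-\<^sup>1)\<close>: one factor \<open>h\<close> is
  cancelled in numerator and denominator; see \<open>alg_bracket\<close> below.\<close>

definition alg_bracket :: "(gword \<Rightarrow>\<^sub>0 complex) \<Rightarrow> free_alg"
  where "alg_bracket x =
    scal (inverse (fps_shift 1 (q - inverse q))) * fps_shift 1 (qexp x - qexp (- x))"

lemma scal_mult: "scal (a * b) = scal a * scal b"
proof -
  have s: "Poly_Mapping.single 0 (\<Sum>i\<in>A. f i) = (\<Sum>i\<in>A. Poly_Mapping.single 0 (f i))"
    for A :: "nat set" and f :: "nat \<Rightarrow> complex"
    by (induction A rule: infinite_finite_induct) (simp_all add: single_add)
  show ?thesis
    unfolding scal_def fps_eq_iff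
    by (simp add: fps_mult_nth s mult_single)
qed

lemma alg_bracket: "scal (q - inverse q) * alg_bracket x = qexp x - qexp (- x)"
proof -
  let ?d = "q - inverse q"
  let ?e = "qexp x - qexp (- x)"
  have iq: "inverse q = fps_exp (- (1 / 2))"
    unfolding q_def by (simp add: fps_exp_neg)
  have d0: "fps_nth ?d 0 = 0" and d1: "fps_nth ?d 1 = 1"
    unfolding iq by (simp_all add: q_def)
  have d: "?d = fps_X * fps_shift 1 ?d"
    using d0 by (intro fps_ext) (simp add: q_def)
  have unit: "fps_shift 1 ?d * inverse (fps_shift 1 ?d) = 1"
    using d1 by (simp add: inverse_mult_eq_1')
  have "fps_nth ?e 0 = 0"
    by (simp add: qexp_def)
  then have e: "?e = fps_X * fps_shift 1 ?e"
    by (intro fps_ext) simp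
  have sX: "scal fps_X = fps_X"
    by (rule fps_ext) (simp add: scal_def fps_X_def single_one)
  have s1: "scal 1 = 1"
    by (rule fps_ext) (simp add: scal_def single_one)
  have "scal ?d * alg_bracket x
      = scal fps_X * (scal (fps_shift 1 ?d) * scal (inverse (fps_shift 1 ?d))) * fps_shift 1 ?e"
    unfolding alg_bracket_def by (subst d) (simp add: scal_mult mult.assoc)
  also have "\<dots> = fps_X * fps_shift 1 ?e"
    unfolding scal_mult[symmetric] unit by (simp add: sX s1)
  finally show ?thesis using e by simp
qed

definition comm :: "'a::ring \<Rightarrow> 'a \<Rightarrow> 'a"
  where "comm x y = x * y - y * x"

definition kron :: "int \<Rightarrow> int \<Rightarrow> int"
  where "kron i j = (if i = j then 1 else 0)"

definition relators :: "free_alg set"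
  where "relators =
      {comm (fgen Gen_c) (fgen g) |g. True}
    \<union> {comm (fgen (Gen_h i)) (fgen (Gen_h j)) |i j. True}
    \<union> {comm (fgen (Gen_h i)) (fgen (Gen_e j))
          - of_int (kron i j - kron i (j + 1)) * fgen (Gen_e j) |i j. True}
    \<union> {comm (fgen (Gen_h i)) (fgen (Gen_f j))
          + of_int (kron i j - kron i (j + 1)) * fgen (Gen_f j) |i j. True}
    \<union> {comm (fgen (Gen_e i)) (fgen (Gen_f i))
          - alg_bracket (letter (Gen_h i) - letter (Gen_h (i + 1))
              + of_int (theta (- i) - theta (- i - 1)) * letter Gen_c) |i. True}
    \<union> {comm (fgen (Gen_e i)) (fgen (Gen_f j)) |i j. i \<noteq> j}
    \<union> {comm (fgen (x i)) (fgen (x j)) |x i j. x \<in> {Gen_e, Gen_f} \<and> \<bar>i - j\<bar> \<noteq> 1}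
    \<union> {fgen (x i) ^ 2 * fgen (x j) - scal (q + inverse q) * fgen (x i) * fgen (x j) * fgen (x i)
          + fgen (x j) * fgen (x i) ^ 2 |x i j. x \<in> {Gen_e, Gen_f} \<and> (j = i + 1 \<or> j = i - 1)}"

text \<open>The topology of \<^typ>\<open>'a fps\<close> in the library is the \<open>h\<close>-adic one.  The closure condition
  makes the quotient complete (and separated), the last condition makes it torsion-free,
  so that the quotient is topologically free.\<close>

definition closed_ideal :: "free_alg set \<Rightarrow> bool"
  where "closed_ideal J \<longleftrightarrow>
     0 \<in> J \<and> (\<forall>x\<in>J. \<forall>y\<in>J. x + y \<in> J) \<and> (\<forall>x\<in>J. \<forall>a. a * x \<in> J \<and> x * a \<in> J)
     \<and> closed J \<and> (\<forall>x. fps_X * x \<in> J \<longrightarrow> x \<in> J)"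

definition rel_ideal :: "free_alg set"
  where "rel_ideal = \<Inter>{J. closed_ideal J \<and> relators \<subseteq> J}"

lemma closed_idealD:
  assumes "closed_ideal J"
  shows "0 \<in> J" "x \<in> J \<Longrightarrow> y \<in> J \<Longrightarrow> x + y \<in> J" "x \<in> J \<Longrightarrow> a * x \<in> J" "x \<in> J \<Longrightarrow> x * a \<in> J"
    "closed J" "fps_X * x \<in> J \<Longrightarrow> x \<in> J"
  using assms unfolding closed_ideal_def by blast+

lemma rel_ideal_iff: "x \<in> rel_ideal \<longleftrightarrow> (\<forall>J. closed_ideal J \<longrightarrow> relators \<subseteq> J \<longrightarrow> x \<in> J)"
  unfolding rel_ideal_def by blast

lemma rel_ideal_0: "0 \<in> rel_ideal"
  and rel_ideal_add: "x \<in> rel_ideal \<Longrightarrow> y \<in> rel_ideal \<Longrightarrow> x + y \<in> rel_ideal"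
  and rel_ideal_left: "x \<in> rel_ideal \<Longrightarrow> a * x \<in> rel_ideal"
  and rel_ideal_right: "x \<in> rel_ideal \<Longrightarrow> x * a \<in> rel_ideal"
  unfolding rel_ideal_iff by (blast intro: closed_idealD(1-4))+

lemma rel_ideal_minus: "x \<in> rel_ideal \<Longrightarrow> - x \<in> rel_ideal"
  using rel_ideal_left[of x "- 1"] by simp

lemma rel_ideal_diff: "x \<in> rel_ideal \<Longrightarrow> y \<in> rel_ideal \<Longrightarrow> x - y \<in> rel_ideal"
  using rel_ideal_add[of x "- y"] rel_ideal_minus[of y] by simp

lemma closed_ideal_rel_ideal: "closed_ideal rel_ideal"
proof -
  have "closed rel_ideal"
    unfolding rel_ideal_def by (rule closed_Inter) (blast dest: closed_idealD(5))
  moreover have "x \<in> rel_ideal" if "fps_X * x \<in> rel_ideal" for x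
    using that closed_idealD(6) unfolding rel_ideal_iff by blast
  ultimately show ?thesis
    unfolding closed_ideal_def
    using rel_ideal_0 rel_ideal_add rel_ideal_left rel_ideal_right by blast
qed

definition rel_eq :: "free_alg \<Rightarrow> free_alg \<Rightarrow> bool"
  where "rel_eq x y \<longleftrightarrow> x - y \<in> rel_ideal"

quotient_type uha = free_alg / rel_eq
proof (rule equivpI)
  show "reflp rel_eq" by (simp add: reflp_def rel_eq_def rel_ideal_0)
  show "symp rel_eq"
  proof (rule sympI)
    fix x y assume "rel_eq x y"
    then show "rel_eq y x" unfolding rel_eq_def by (drule_tac rel_ideal_minus) simp
  qed
  show "transp rel_eq"
  proof (rule transpI)
    fix x y z assume "rel_eq x y" "rel_eq y z"
    then have "(x - y) + (y - z) \<in> rel_ideal" unfolding rel_eq_def by (rule rel_ideal_add)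
    then show "rel_eq x z" by (simp add: rel_eq_def)
  qed
qed

instantiation uha :: "{ring, monoid_mult}"
begin

lift_definition zero_uha :: uha is 0 .
lift_definition one_uha :: uha is 1 .
lift_definition plus_uha :: "uha \<Rightarrow> uha \<Rightarrow> uha" is "(+)"
proof -
  fix x x' y y' assume "rel_eq x x'" "rel_eq y y'"
  then have "(x - x') + (y - y') \<in> rel_ideal" unfolding rel_eq_def by (rule rel_ideal_add)
  then show "rel_eq (x + y) (x' + y')" by (simp add: rel_eq_def algebra_simps)
qed
lift_definition uminus_uha :: "uha \<Rightarrow> uha" is uminus
proof -
  fix x x' assume "rel_eq x x'"
  then have "- (x - x') \<in> rel_ideal" unfolding rel_eq_def by (rule rel_ideal_minus)
  then show "rel_eq (- x) (- x')" by (simp add: rel_eq_def)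
qed
lift_definition minus_uha :: "uha \<Rightarrow> uha \<Rightarrow> uha" is "(-)"
proof -
  fix x x' y y' assume "rel_eq x x'" "rel_eq y y'"
  then have "(x - x') - (y - y') \<in> rel_ideal" unfolding rel_eq_def by (rule rel_ideal_diff)
  then show "rel_eq (x - y) (x' - y')" by (simp add: rel_eq_def algebra_simps)
qed
lift_definition times_uha :: "uha \<Rightarrow> uha \<Rightarrow> uha" is "(*)"
proof -
  fix x x' y y' assume "rel_eq x x'" "rel_eq y y'"
  then have "(x - x') * y + x' * (y - y') \<in> rel_ideal"
    unfolding rel_eq_def by (intro rel_ideal_add rel_ideal_left rel_ideal_right)
  then show "rel_eq (x * y) (x' * y')" by (simp add: rel_eq_def algebra_simps)
qed

instance
  by standard (transfer; simp add: rel_eq_def rel_ideal_0 algebra_simps)+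

end

lift_definition hscale :: "complex fps \<Rightarrow> uha \<Rightarrow> uha" is "\<lambda>a x. scal a * x"
  unfolding rel_eq_def by (simp add: rel_ideal_left flip: right_diff_distrib)

lift_definition ugen :: "gen \<Rightarrow> uha" is fgen .

inductive_set subalgebra_gen :: "uha set \<Rightarrow> uha set" for G :: "uha set"
  where
    "1 \<in> subalgebra_gen G"
  | "x \<in> G \<Longrightarrow> x \<in> subalgebra_gen G"
  | "x \<in> subalgebra_gen G \<Longrightarrow> y \<in> subalgebra_gen G \<Longrightarrow> x + y \<in> subalgebra_gen G"
  | "x \<in> subalgebra_gen G \<Longrightarrow> y \<in> subalgebra_gen G \<Longrightarrow> x * y \<in> subalgebra_gen G"
  | "x \<in> subalgebra_gen G \<Longrightarrow> hscale a x \<in> subalgebra_gen G"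

definition U_plus :: "uha set"
  where "U_plus = subalgebra_gen (range (\<lambda>i. ugen (Gen_e i)))"

definition U_minus :: "uha set"
  where "U_minus = subalgebra_gen (range (\<lambda>i. ugen (Gen_f i)))"

text \<open>An element of \<open>H = \<Oplus>\<^sub>i \<complex> h\<^sub>i\<close> is given by its coordinates, an element of
  \<open>Q'\<^sub>+ = \<Oplus>\<^sub>i \<int>\<^sub>+ \<alpha>\<^sub>i\<close> by its multiplicities; \<open>S(\<alpha>)\<close> is
  then \<^const>\<open>Poly_Mapping.keys\<close>.\<close>

definition H_elem :: "(int \<Rightarrow>\<^sub>0 complex) \<Rightarrow> uha"
  where "H_elem x = (\<Sum>i\<in>Poly_Mapping.keys x.
      hscale (fps_const (Poly_Mapping.lookup x i)) (ugen (Gen_h i)))"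

definition eps :: "int \<Rightarrow> (int \<Rightarrow>\<^sub>0 complex) \<Rightarrow> complex"
  where "eps i x = Poly_Mapping.lookup x i"

definition simple_root :: "int \<Rightarrow> (int \<Rightarrow>\<^sub>0 complex) \<Rightarrow> complex"
  where "simple_root i x = eps i x - eps (i + 1) x"

definition root_eval :: "(int \<Rightarrow>\<^sub>0 nat) \<Rightarrow> (int \<Rightarrow>\<^sub>0 complex) \<Rightarrow> complex"
  where "root_eval \<alpha> x = (\<Sum>i\<in>Poly_Mapping.keys \<alpha>.
      of_nat (Poly_Mapping.lookup \<alpha> i) * simple_root i x)"

definition U_plus_weight :: "(int \<Rightarrow>\<^sub>0 nat) \<Rightarrow> uha set"
  where "U_plus_weight \<alpha> =
    (if \<alpha> = 0 then range (\<lambda>a. hscale a 1)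
     else {x \<in> U_plus. \<forall>h'. comm (H_elem h') x = hscale (fps_const (root_eval \<alpha> h')) x})"

text \<open>\<open>U_minus_weight \<alpha>\<close> is the component of weight \<open>-\<alpha>\<close>.\<close>

definition U_minus_weight :: "(int \<Rightarrow>\<^sub>0 nat) \<Rightarrow> uha set"
  where "U_minus_weight \<alpha> =
    (if \<alpha> = 0 then range (\<lambda>a. hscale a 1)
     else {x \<in> U_minus. \<forall>h'. comm (H_elem h') x = hscale (fps_const (- root_eval \<alpha> h')) x})"


section \<open>\<open>C\<close>-patterns and the module \<open>V\<close>\<close>

text \<open>The entry \<open>M\<^sub>i\<^sub>,\<^sub>p\<close> of an array is \<open>P i p\<close>.  Outside of the index range of the
  pattern the value is 0, so that a pattern is determined by its entries.\<close>

type_synonym array = "int \<Rightarrow> int \<Rightarrow> complex poly"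
type_synonym sig = "int \<Rightarrow> complex poly"

definition in_range :: "int \<Rightarrow> int \<Rightarrow> bool"
  where "in_range i p \<longleftrightarrow> (\<exists>k\<ge>1. \<exists>t\<in>{0, 1}. p = 2 * k + t - 1 \<and> i \<in> {1 - t - k .. k - 1})"

definition stable_from :: "sig \<Rightarrow> int \<Rightarrow> array \<Rightarrow> bool"
  where "stable_from M N P \<longleftrightarrow> (\<forall>k\<ge>1. \<forall>t\<in>{0, 1}. 2 * k + t - 1 \<ge> N \<longrightarrow>
      (\<forall>i\<in>{1 - t - k .. k - 1}. P i (2 * k + t - 1) = M i))"

definition C_patterns :: "sig \<Rightarrow> array set"
  where "C_patterns M = {P.
      (\<forall>i p. \<not> in_range i p \<longrightarrow> P i p = 0)
    \<and> (\<exists>N>1. stable_from M N P)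
    \<and> (\<forall>k\<ge>1. \<forall>t\<in>{0, 1}. \<forall>i\<in>{1 - t - k .. k - 1}.
          P (i + t - 1) (2 * k + t) - P i (2 * k + t - 1) \<in> \<nat>
        \<and> P i (2 * k + t - 1) - P (i + t) (2 * k + t) \<in> \<nat>)}"

type_synonym vec = "array \<Rightarrow> complex fps"

definition vscale :: "complex fps \<Rightarrow> vec \<Rightarrow> vec"
  where "vscale a v = (\<lambda>P. a * v P)"

interpretation hmod: module vscale
  by standard (auto simp: vscale_def fun_eq_iff algebra_simps)

text \<open>The basis vector \<open>|P)\<close>; arrays that are not \<open>C\<close>-patterns give 0, which is the convention
  that such terms are deleted in the formulas for the action.\<close>

definition ket :: "sig \<Rightarrow> array \<Rightarrow> vec"
  where "ket M P = (\<lambda>P'. if P \<in> C_patterns M \<and> P' = P then 1 else 0)"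

definition V_hat :: "sig \<Rightarrow> vec set"
  where "V_hat M = hmod.span {ket M P |P. P \<in> C_patterns M}"

definition V_sub :: "sig \<Rightarrow> int \<Rightarrow> vec set"
  where "V_sub M N = hmod.span {ket M P |P. P \<in> C_patterns M \<and> stable_from M N P}"

text \<open>The \<open>h\<close>-adic completion of \<^const>\<open>V_hat\<close>: families of coordinates of which, for every \<open>n\<close>,
  only finitely many are nonzero modulo \<open>h\<^sup>n\<close>.\<close>

definition V_compl :: "sig \<Rightarrow> vec set"
  where "V_compl M = {v. (\<forall>P. P \<notin> C_patterns M \<longrightarrow> v P = 0)
      \<and> (\<forall>n. finite {P. \<not> fps_X ^ n dvd v P})}"

definition hadic_sums :: "sig \<Rightarrow> (nat \<Rightarrow> vec) \<Rightarrow> vec \<Rightarrow> bool"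
  where "hadic_sums M f v \<longleftrightarrow> (\<forall>n. \<exists>K0. \<forall>K\<ge>K0. \<exists>w\<in>V_compl M.
      v - (\<Sum>k<K. f k) = vscale (fps_X ^ n) w)"


section \<open>The representation\<close>

definition bump :: "array \<Rightarrow> int \<Rightarrow> int \<Rightarrow> int \<Rightarrow> array"
  \<comment> \<open>\<open>M\<^sub>j\<^sub>,\<^sub>p \<rightarrow> M\<^sub>j\<^sub>,\<^sub>p + s\<close>\<close>
  where "bump P s j p = (\<lambda>i r. if i = j \<and> r = p then P i r + of_int s else P i r)"

text \<open>The integer \<open>L\<^sub>r\<^sub>,\<^sub>p - L\<^sub>j\<^sub>,\<^sub>s\<close>, where \<open>L\<^sub>i\<^sub>,\<^sub>p = M\<^sub>i\<^sub>,\<^sub>p - i\<close>.  For a \<open>C\<close>-pattern of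
  a signature with integral differences, all these polynomials are integers.\<close>

definition Lentry :: "array \<Rightarrow> int \<Rightarrow> int \<Rightarrow> complex poly"
  where "Lentry P i p = P i p - of_int i"

definition Ldiff :: "array \<Rightarrow> int \<Rightarrow> int \<Rightarrow> int \<Rightarrow> int \<Rightarrow> int"
  where "Ldiff P r p j s = (THE z. Lentry P r p - Lentry P j s = of_int z)"

definition abs_bracket :: "int \<Rightarrow> complex fps"
  where "abs_bracket n = qbracket \<bar>n\<bar>"

definition Ssign :: "int \<Rightarrow> int \<Rightarrow> nat \<Rightarrow> complex fps"
  where "Ssign j l \<nu> = (if j = l then (- 1) ^ \<nu> else if j < l then 1 else - 1)"

text \<open>\<open>absX\<close> and \<open>absY\<close> are \<open>|X\<^sub>j\<^sub>,\<^sub>l|\<close> and \<open>|Y\<^sub>j\<^sub>,\<^sub>l|\<close>.  If a denominator vanishes, the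
  corresponding term in the action is one of the deleted ones; otherwise it is a unit.\<close>

definition absX :: "array \<Rightarrow> int \<Rightarrow> nat \<Rightarrow> nat \<Rightarrow> int \<Rightarrow> int \<Rightarrow> complex fps"
  where "absX P i \<mu> \<nu> j l =
      (\<Prod>r\<in>{- i .. i + int \<nu> - 1} - {l}.
          abs_bracket (Ldiff P r (2 * i + int \<nu>) j (2 * i + int \<nu> - 1) - (- 1) ^ \<nu> * int \<mu>))
    * (\<Prod>r\<in>{1 - i .. i + int \<nu> - 2}.
          abs_bracket (Ldiff P r (2 * i + int \<nu> - 2) j (2 * i + int \<nu> - 1) - (- 1) ^ \<nu> * int \<mu>))
    / (\<Prod>r\<in>{1 - i - int \<nu> .. i - 1} - {j}.
          abs_bracket (Ldiff P r (2 * i + int \<nu> - 1) j (2 * i + int \<nu> - 1))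
        * abs_bracket (Ldiff P r (2 * i + int \<nu> - 1) j (2 * i + int \<nu> - 1) + (- 1) ^ (\<mu> + \<nu>)))"

definition absY :: "array \<Rightarrow> int \<Rightarrow> nat \<Rightarrow> nat \<Rightarrow> int \<Rightarrow> int \<Rightarrow> complex fps"
  where "absY P i \<mu> \<nu> j l =
      (\<Prod>r\<in>{- i - int \<nu> .. i}.
          abs_bracket (Ldiff P r (2 * i + int \<nu> + 1) l (2 * i + int \<nu>) + (- 1) ^ \<nu> * (1 - int \<mu>)))
    * (\<Prod>r\<in>{1 - i - int \<nu> .. i - 1} - {j}.
          abs_bracket (Ldiff P r (2 * i + int \<nu> - 1) l (2 * i + int \<nu>) + (- 1) ^ \<nu> * (1 - int \<mu>)))
    / (\<Prod>r\<in>{- i .. i + int \<nu> - 1} - {l}.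
          abs_bracket (Ldiff P r (2 * i + int \<nu>) l (2 * i + int \<nu>))
        * abs_bracket (Ldiff P r (2 * i + int \<nu>) l (2 * i + int \<nu>) + (- 1) ^ (\<mu> + \<nu>)))"

definition egen :: "nat \<Rightarrow> int \<Rightarrow> uha"
  where "egen \<mu> i = ugen (if \<mu> = 0 then Gen_f i else Gen_e i)"

definition h_eigenvalue :: "complex poly \<Rightarrow> complex poly \<Rightarrow> array \<Rightarrow> int \<Rightarrow> complex poly"
  where "h_eigenvalue \<xi>\<^sub>0 \<xi>\<^sub>1 P i =
      (\<Sum>j\<in>{- \<bar>i\<bar> .. \<bar>i\<bar> + theta i - 1}. P j (2 * \<bar>i\<bar> + theta i))
    - (\<Sum>j\<in>{- \<bar>i\<bar> + 1 - theta i .. \<bar>i\<bar> - 1}. P j (2 * \<bar>i\<bar> + theta i - 1))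
    + (\<xi>\<^sub>1 - \<xi>\<^sub>0) * of_int (theta (- i)) - \<xi>\<^sub>1"

text \<open>A \<^typ>\<open>complex fps\<close>-linear representation of the algebra \<^typ>\<open>uha\<close> in the module
  \<^term>\<open>V_compl M\<close>.  Linearity implies continuity for the \<open>h\<close>-adic topologies.\<close>

definition is_representation :: "sig \<Rightarrow> (uha \<Rightarrow> vec \<Rightarrow> vec) \<Rightarrow> bool"
  where "is_representation M \<rho> \<longleftrightarrow>
      (\<forall>x. \<forall>v\<in>V_compl M. \<rho> x v \<in> V_compl M)
    \<and> (\<forall>x. \<forall>v\<in>V_compl M. \<forall>w\<in>V_compl M. \<rho> x (v + w) = \<rho> x v + \<rho> x w)
    \<and> (\<forall>x a. \<forall>v\<in>V_compl M. \<rho> x (vscale a v) = vscale a (\<rho> x v))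
    \<and> (\<forall>x y. \<forall>v\<in>V_compl M. \<rho> (x + y) v = \<rho> x v + \<rho> y v)
    \<and> (\<forall>x a. \<forall>v\<in>V_compl M. \<rho> (hscale a x) v = vscale a (\<rho> x v))
    \<and> (\<forall>x y. \<forall>v\<in>V_compl M. \<rho> (x * y) v = \<rho> x (\<rho> y v))
    \<and> (\<forall>v\<in>V_compl M. \<rho> 1 v = v)"

text \<open>\<open>\<rho>\<close> is the representation in \<open>V({M}; \<xi>\<^sub>0, \<xi>\<^sub>1)\<close>.  Since the algebra is topologically
  generated by \<open>e\<^sub>i\<close>, \<open>f\<^sub>i\<close>, \<open>h\<^sub>i\<close>, \<open>c\<close>, it is determined on \<^term>\<open>V_compl M\<close> by its values on
  generators and basis vectors.\<close>

definition is_pattern_rep ::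
    "sig \<Rightarrow> complex poly \<Rightarrow> complex poly \<Rightarrow> (uha \<Rightarrow> vec \<Rightarrow> vec) \<Rightarrow> bool"
  where "is_pattern_rep M \<xi>\<^sub>0 \<xi>\<^sub>1 \<rho> \<longleftrightarrow> is_representation M \<rho> \<and>
    (\<forall>P\<in>C_patterns M.
      (\<forall>\<mu>\<in>{0, 1}. \<rho> (egen (1 - \<mu>) (- 1)) (ket M P) =
          vscale (pos_sqrt (qbracket (Ldiff P (- 1) 2 0 1 - int \<mu>)
                          * qbracket (Ldiff P 0 1 0 2 + int \<mu>)))
            (ket M (bump P (- ((- 1) ^ \<mu>)) 0 1)))
    \<and> (\<forall>i\<ge>1. \<forall>\<mu>\<in>{0, 1}. \<forall>\<nu>\<in>{0, 1}. \<rho> (egen \<mu> ((- 1) ^ \<nu> * i - 1)) (ket M P) =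
          - (\<Sum>j\<in>{1 - i - int \<nu> .. i - 1}. \<Sum>l\<in>{- i .. i + int \<nu> - 1}.
              vscale (Ssign j l \<nu> * pos_sqrt (absX P i \<mu> \<nu> j l * absY P i \<mu> \<nu> j l))
                (ket M (bump (bump P (- ((- 1) ^ (\<mu> + \<nu>))) j (2 * i + int \<nu> - 1))
                          (- ((- 1) ^ (\<mu> + \<nu>))) l (2 * i + int \<nu>)))))
    \<and> (\<forall>i. \<rho> (ugen (Gen_h i)) (ket M P) =
          vscale (fps_of_poly (h_eigenvalue \<xi>\<^sub>0 \<xi>\<^sub>1 P i)) (ket M P))
    \<and> \<rho> (ugen Gen_c) (ket M P) = vscale (fps_of_poly (\<xi>\<^sub>0 - \<xi>\<^sub>1)) (ket M P))"

end

theory Submission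
  imports Defs
begin

text \<open>The vector \<open>v\<^sub>k\<close> is a finite combination of patterns \<open>P\<close> that agree with the signature from
  some row \<open>N\<close> on, so it suffices to let the algebra act on one such \<open>P\<close>.  A generator
  \<open>e\<^sub>s\<close> or \<open>f\<^sub>s\<close> changes two adjacent rows of \<open>P\<close> (one, if \<open>s = - 1\<close>), at height about \<open>2 \<bar>s\<bar>\<close>,
  and the interlacing conditions with neighbouring rows decide whether the changed array is a pattern;
  if none of the changed arrays is one, the generator kills \<open>P\<close>.

  The generator \<open>e\<^sub>s\<close> pushes an entry of its upper row past the entry of the next row that bounds it.
  If both rows are stable, these two entries are equal and the result is not a pattern
  (\<open>raise_not_pattern\<close>, \<open>lower_not_pattern\<close>).  So \<open>e\<^sub>s\<close> either kills \<open>P\<close> or changes only rows below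
  \<open>N\<close>.  The patterns stable from \<open>N\<close> thus span a subspace that is invariant under all \<open>e\<^sub>s\<close> and
  killed by those with \<open>\<bar>s\<bar> \<ge> r\<close>, and every word in the \<open>e\<^sub>i\<close> with such a letter vanishes on it
  (\<open>e_word_with_far_letter_kills\<close>).  The generator \<open>f\<^sub>s\<close> pushes entries the other way, where
  gaps of the signature may leave room.  For \<open>\<bar>s\<bar> \<ge> r\<close> the row below the two changed ones is
  stable as well and the signature is constant near column \<open>s\<close>, so \<open>f\<^sub>s\<close> kills \<open>P\<close>
  (\<open>far_f_kills\<close>).  The invariant subspace is lost, which is why for the \<open>f\<^sub>i\<close> all letters are
  required to be far: the first one to act already kills.

  To pass from words to elements of a weight space, let \<open>x\<close> have weight \<open>\<beta>\<close>.  Then \<open>\<rho> x P\<close> is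
  a combination of vectors \<open>\<rho> w P\<close> with words \<open>w\<close>, and since basis vectors are weight vectors, each
  coordinate of \<open>\<rho> x P\<close> can only come from words of weight \<open>\<beta>\<close>.  Their sets of letters are
  \<open>S(\<beta>)\<close> (\<open>weight_element_kills_ket\<close>).  Finally, the eigenvalue of \<open>h\<^sub>i\<close> is a difference of sums
  over two adjacent rows.  When they are stable it telescopes to \<open>M\<^sub>i\<close> minus its limit.\<close>


section \<open>Linear algebra in the module\<close>

lemma subspace_V_compl: "hmod.subspace (V_compl M)"
proof (rule hmod.subspaceI)
  show "0 \<in> V_compl M"
    by (simp add: V_compl_def)
next
  fix v w assume v: "v \<in> V_compl M" and w: "w \<in> V_compl M"
  have "finite {P. \<not> fps_X ^ n dvd (v + w) P}" for n
  proof (rule finite_subset)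
    show "{P. \<not> fps_X ^ n dvd (v + w) P} \<subseteq> {P. \<not> fps_X ^ n dvd v P} \<union> {P. \<not> fps_X ^ n dvd w P}"
      by auto
    show "finite ({P. \<not> fps_X ^ n dvd v P} \<union> {P. \<not> fps_X ^ n dvd w P})"
      using v w by (simp add: V_compl_def)
  qed
  with v w show "v + w \<in> V_compl M"
    by (simp add: V_compl_def)
next
  fix c v assume v: "v \<in> V_compl M"
  have "finite {P. \<not> fps_X ^ n dvd vscale c v P}" for n
  proof (rule finite_subset)
    show "{P. \<not> fps_X ^ n dvd vscale c v P} \<subseteq> {P. \<not> fps_X ^ n dvd v P}"
      by (auto simp: vscale_def)
    show "finite {P. \<not> fps_X ^ n dvd v P}"
      using v by (simp add: V_compl_def)
  qed
  with v show "vscale c v \<in> V_compl M"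
    by (simp add: V_compl_def vscale_def)
qed

lemma ket_in_V_compl: "ket M P \<in> V_compl M"
proof -
  have "finite {Q. \<not> fps_X ^ n dvd ket M P Q}" for n
    by (rule finite_subset[of _ "{P}"]) (auto simp: ket_def)
  then show ?thesis
    by (auto simp: V_compl_def ket_def)
qed

lemma V_hat_subset_V_compl: "V_hat M \<subseteq> V_compl M"
  unfolding V_hat_def
  by (rule hmod.span_minimal) (auto simp: subspace_V_compl ket_in_V_compl)

lemma V_sub_subset_V_hat: "V_sub M N \<subseteq> V_hat M"
  unfolding V_hat_def V_sub_def by (rule hmod.span_mono) auto

lemma V_sub_subset_V_compl: "V_sub M N \<subseteq> V_compl M"
  using V_sub_subset_V_hat V_hat_subset_V_compl by (rule subset_trans)

lemma ket_in_V_hat: "ket M P \<in> V_hat M"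
proof (cases "P \<in> C_patterns M")
  case True
  then show ?thesis unfolding V_hat_def by (intro hmod.span_base) auto
next
  case False
  then have "ket M P = 0" by (auto simp: ket_def)
  then show ?thesis by (simp add: V_hat_def hmod.span_zero)
qed

lemma stable_from_mono: "stable_from M N P \<Longrightarrow> N \<le> N' \<Longrightarrow> stable_from M N' P"
  unfolding stable_from_def by (meson order_trans)

lemma V_sub_mono: "N \<le> N' \<Longrightarrow> V_sub M N \<subseteq> V_sub M N'"
  unfolding V_sub_def by (rule hmod.span_mono) (auto intro: stable_from_mono)

lemma V_hat_exhausted_by_V_sub:
  assumes "v \<in> V_hat M"
  shows "\<exists>N>1. v \<in> V_sub M N"
  using assms unfolding V_hat_def
proof (induction rule: hmod.span_induct_alt)
  case base
  show "\<exists>N>1. 0 \<in> V_sub M N"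
    by (intro exI[of _ 2]) (simp add: V_sub_def hmod.span_zero)
next
  case (step c x y)
  then obtain P N N' where P: "x = ket M P" "P \<in> C_patterns M"
    and N: "N > 1" "stable_from M N P" and y: "N' > 1" "y \<in> V_sub M N'"
    by (auto simp: C_patterns_def)
  have "x \<in> V_sub M N"
    unfolding V_sub_def using P N by (intro hmod.span_base) auto
  then have "x \<in> V_sub M (max N N')" and "y \<in> V_sub M (max N N')"
    using y V_sub_mono[of N "max N N'"] V_sub_mono[of N' "max N N'"] by auto
  then have "vscale c x + y \<in> V_sub M (max N N')"
    unfolding V_sub_def by (intro hmod.span_add hmod.span_scale)
  moreover have "max N N' > 1" using N(1) by simp
  ultimately show ?case by blast
qed

lemma span_coordinate_nonzero:
  fixes v :: vec
  assumes "v \<in> hmod.span B" and "v Q \<noteq> 0"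
  obtains b where "b \<in> B" "b Q \<noteq> 0"
proof -
  have "v Q = 0" if "\<forall>b\<in>B. b Q = 0"
    using assms(1) by (induction rule: hmod.span_induct_alt) (auto simp: vscale_def that)
  with assms(2) that show thesis by blast
qed


section \<open>Weights\<close>

locale rep =
  fixes M :: sig and \<rho> :: "uha \<Rightarrow> vec \<Rightarrow> vec"
  assumes rep: "is_representation M \<rho>"
begin

lemma closed: "v \<in> V_compl M \<Longrightarrow> \<rho> x v \<in> V_compl M"
  and add: "v \<in> V_compl M \<Longrightarrow> w \<in> V_compl M \<Longrightarrow> \<rho> x (v + w) = \<rho> x v + \<rho> x w"
  and scale: "v \<in> V_compl M \<Longrightarrow> \<rho> x (vscale a v) = vscale a (\<rho> x v)"
  and add_left: "v \<in> V_compl M \<Longrightarrow> \<rho> (x + y) v = \<rho> x v + \<rho> y v"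
  and hscale_left: "v \<in> V_compl M \<Longrightarrow> \<rho> (hscale a x) v = vscale a (\<rho> x v)"
  and mult_left: "v \<in> V_compl M \<Longrightarrow> \<rho> (x * y) v = \<rho> x (\<rho> y v)"
  and one_left: "v \<in> V_compl M \<Longrightarrow> \<rho> 1 v = v"
  using rep unfolding is_representation_def by blast+

lemma zero: "\<rho> x 0 = 0"
  using scale[of 0 x 0] subspace_V_compl[of M] by (simp add: hmod.subspace_0)

lemma diff_left: "v \<in> V_compl M \<Longrightarrow> \<rho> (x - y) v = \<rho> x v - \<rho> y v"
  using add_left[of v "x - y" y] by simp

lemma span_into:
  assumes "B \<subseteq> V_compl M" "hmod.subspace S" "\<And>b. b \<in> B \<Longrightarrow> \<rho> x b \<in> S" "v \<in> hmod.span B"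
  shows "\<rho> x v \<in> S"
proof -
  have "hmod.subspace {v \<in> V_compl M. \<rho> x v \<in> S}"
    using subspace_V_compl[of M] assms(2)
    by (auto simp: hmod.subspace_def zero add scale)
  then have "hmod.span B \<subseteq> {v \<in> V_compl M. \<rho> x v \<in> S}"
    using assms(1,3) by (intro hmod.span_minimal) auto
  with assms(4) show ?thesis by auto
qed

text \<open>Words span the subalgebra.  Stated on the module, this follows from the linearity of \<open>\<rho> x\<close>;
  stated in the algebra, it would first need that scalars are central there.\<close>

lemma subalgebra_span_words:
  assumes "x \<in> subalgebra_gen (range g)" and "v \<in> V_compl M"
  shows "\<rho> x v \<in> hmod.span {\<rho> (prod_list (map g w)) v |w. True}"
  using assms
proof (induction arbitrary: v rule: subalgebra_gen.induct)
  case 1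
  have "\<rho> 1 v = \<rho> (prod_list (map g [])) v" by simp
  then show ?case by (intro hmod.span_base) blast
next
  case (2 x)
  then obtain i where "x = g i" by blast
  then have "\<rho> x v = \<rho> (prod_list (map g [i])) v" by simp
  then show ?case by (intro hmod.span_base) blast
next
  case (3 x y)
  then show "\<rho> (x + y) v \<in> hmod.span {\<rho> (prod_list (map g w)) v |w. True}"
    by (simp add: add_left hmod.span_add)
next
  case (4 x y)
  let ?B = "{\<rho> (prod_list (map g w)) v |w. True}"
  have *: "\<rho> x b \<in> hmod.span ?B" if "b \<in> ?B" for b
  proof -
    from that obtain w where b: "b = \<rho> (prod_list (map g w)) v" by blast
    have "\<rho> x b \<in> hmod.span {\<rho> (prod_list (map g w')) b |w'. True}"
      using 4 b by (simp add: closed)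
    also have "\<dots> \<subseteq> hmod.span ?B"
    proof (rule hmod.span_mono, safe)
      fix w'
      have "\<rho> (prod_list (map g w')) b = \<rho> (prod_list (map g (w' @ w))) v"
        using 4(5) by (simp add: b mult_left)
      then show "\<exists>w''. \<rho> (prod_list (map g w')) b = \<rho> (prod_list (map g w'')) v \<and> True" by blast
    qed
    finally show ?thesis .
  qed
  have "\<rho> x (\<rho> y v) \<in> hmod.span ?B"
  proof (rule span_into[OF _ hmod.subspace_span *])
    show "?B \<subseteq> V_compl M" using 4(5) closed by blast
    show "\<rho> y v \<in> hmod.span ?B" using 4(4,5) .
  qed
  then show ?case using 4 by (simp add: mult_left)
next
  case (5 x a)
  then show ?case by (simp add: hscale_left hmod.span_scale)
qed

end

lemma H_elem_single: "H_elem (Poly_Mapping.single i 1) = hscale 1 (ugen (Gen_h i))"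
  by (simp add: H_elem_def)

lemma root_eval_single:
  "root_eval \<beta> (Poly_Mapping.single i 1)
    = of_int (int (Poly_Mapping.lookup \<beta> i) - int (Poly_Mapping.lookup \<beta> (i - 1)))"
proof -
  have "root_eval \<beta> (Poly_Mapping.single i 1)
      = (\<Sum>j\<in>Poly_Mapping.keys \<beta>. (if j = i then of_nat (Poly_Mapping.lookup \<beta> j) else 0)
          - (if j = i - 1 then of_nat (Poly_Mapping.lookup \<beta> j) else 0))"
    unfolding root_eval_def
    by (intro sum.cong) (auto simp: simple_root_def eps_def lookup_single when_def)
  also have "\<dots> = of_nat (Poly_Mapping.lookup \<beta> i) - of_nat (Poly_Mapping.lookup \<beta> (i - 1))"
    by (simp add: sum_subtractf not_in_keys_iff_lookup_eq_zero)
  finally show ?thesis by simp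
qed

lemma sum_list_kron:
  "(\<Sum>j\<leftarrow>w. kron i j - kron i (j + 1)) = int (count_list w i) - int (count_list w (i - 1))"
  by (induction w) (auto simp: kron_def)

text \<open>A finitely supported family on the integers is determined by its first differences;
  this is the linear independence of the simple roots as functionals on \<open>H\<close>.\<close>

lemma finite_support_eq_if_differences_eq:
  fixes f g :: "int \<Rightarrow> nat"
  assumes diff: "\<And>i. int (f i) - int (f (i - 1)) = int (g i) - int (g (i - 1))"
    and fin: "finite {i. f i \<noteq> 0}" "finite {i. g i \<noteq> 0}"
  shows "f = g"
proof -
  define d where "d i = int (f i) - int (g i)" for i
  have step: "d i = d (i - 1)" for i
    using diff[of i] by (simp add: d_def)
  have const: "d i = d 0" for i
  proof (induction i rule: int_induct[of _ 0])
    case (step1 i)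
    then show ?case using step[of "i + 1"] by simp
  next
    case (step2 i)
    then show ?case using step[of i] by simp
  qed simp
  have "\<exists>i. i \<notin> {i. f i \<noteq> 0} \<union> {i. g i \<noteq> 0}"
    using fin by (intro ex_new_if_finite) (simp_all add: infinite_UNIV_int)
  then obtain i where "f i = 0" "g i = 0" by blast
  then have "d i = 0" by (simp add: d_def)
  then have "d j = 0" for j using const[of i] const[of j] by simp
  then show ?thesis by (auto simp: d_def fun_eq_iff)
qed

lemma scal_of_int: "scal (of_int k) = of_int k"
proof -
  have "scal (of_int k) = fps_const (of_int k)"
    by (rule fps_ext) (simp add: scal_def fps_of_int[symmetric] del: fps_of_int)
  then show ?thesis by (simp add: fps_of_int)
qed

lemma relator_imp_eq: "x - y \<in> relators \<Longrightarrow> rel_eq x y"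
  unfolding rel_eq_def rel_ideal_def by blast

lemma comm_h_e:
  "comm (ugen (Gen_h i)) (ugen (Gen_e j))
    = hscale (of_int (1 * (kron i j - kron i (j + 1)))) (ugen (Gen_e j))"
  unfolding comm_def
proof transfer
  fix i j
  have "comm (fgen (Gen_h i)) (fgen (Gen_e j))
      - of_int (kron i j - kron i (j + 1)) * fgen (Gen_e j) \<in> relators"
    unfolding relators_def by blast
  then show "rel_eq (fgen (Gen_h i) * fgen (Gen_e j) - fgen (Gen_e j) * fgen (Gen_h i))
      (scal (of_int (1 * (kron i j - kron i (j + 1)))) * fgen (Gen_e j))"
    unfolding scal_of_int mult_1 by (intro relator_imp_eq) (simp only: comm_def)
qed

lemma comm_h_f:
  "comm (ugen (Gen_h i)) (ugen (Gen_f j))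
    = hscale (of_int (- 1 * (kron i j - kron i (j + 1)))) (ugen (Gen_f j))"
  unfolding comm_def
proof transfer
  fix i j
  have "comm (fgen (Gen_h i)) (fgen (Gen_f j))
      + of_int (kron i j - kron i (j + 1)) * fgen (Gen_f j) \<in> relators"
    unfolding relators_def by blast
  then show "rel_eq (fgen (Gen_h i) * fgen (Gen_f j) - fgen (Gen_f j) * fgen (Gen_h i))
      (scal (of_int (- 1 * (kron i j - kron i (j + 1)))) * fgen (Gen_f j))"
    unfolding scal_of_int by (intro relator_imp_eq) (simp add: comm_def algebra_simps)
qed

locale pattern_rep = rep M \<rho> for M \<rho> +
  fixes \<xi>\<^sub>0 \<xi>\<^sub>1 :: "complex poly"
  assumes pattern_rep: "is_pattern_rep M \<xi>\<^sub>0 \<xi>\<^sub>1 \<rho>"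
begin

abbreviation eigenvalue :: "array \<Rightarrow> int \<Rightarrow> complex fps"
  where "eigenvalue P i \<equiv> fps_of_poly (h_eigenvalue \<xi>\<^sub>0 \<xi>\<^sub>1 P i)"

lemma h_ket: "P \<in> C_patterns M \<Longrightarrow> \<rho> (ugen (Gen_h i)) (ket M P) = vscale (eigenvalue P i) (ket M P)"
  using pattern_rep unfolding is_pattern_rep_def by blast

text \<open>Vectors are coordinate functions, so the diagonal operator \<open>h\<^sub>i\<close> acts by pointwise multiplication
  with its eigenvalues; as the scalars form a domain, the support of a weight vector consists of
  basis vectors of the same weight.\<close>

lemma h_coordinate:
  assumes "v \<in> V_hat M"
  shows "\<rho> (ugen (Gen_h i)) v Q = eigenvalue Q i * v Q"
proof -
  have "\<rho> (ugen (Gen_h i)) v Q = eigenvalue Q i * v Q \<and> v \<in> V_compl M"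
    using assms unfolding V_hat_def
  proof (induction rule: hmod.span_induct_alt)
    case base
    show "\<rho> (ugen (Gen_h i)) 0 Q = eigenvalue Q i * 0 Q \<and> 0 \<in> V_compl M"
      using subspace_V_compl[of M] by (simp add: zero hmod.subspace_0)
  next
    case (step c x y)
    then obtain P where "P \<in> C_patterns M" "x = ket M P" by blast
    then have *: "\<rho> (ugen (Gen_h i)) x Q = eigenvalue Q i * x Q" and x: "x \<in> V_compl M"
      using ket_in_V_compl by (simp_all add: h_ket) (simp add: vscale_def ket_def)
    have cx: "vscale c x \<in> V_compl M"
      using x subspace_V_compl by (simp add: hmod.subspace_scale)
    have "\<rho> (ugen (Gen_h i)) (vscale c x + y)
        = vscale c (\<rho> (ugen (Gen_h i)) x) + \<rho> (ugen (Gen_h i)) y"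
      using add[OF cx] scale[OF x] step by simp
    with step * have "\<rho> (ugen (Gen_h i)) (vscale c x + y) Q = eigenvalue Q i * (vscale c x + y) Q"
      by (simp add: vscale_def algebra_simps)
    moreover have "vscale c x + y \<in> V_compl M"
      using cx step subspace_V_compl by (simp add: hmod.subspace_add)
    ultimately show "\<rho> (ugen (Gen_h i)) (vscale c x + y) Q = eigenvalue Q i * (vscale c x + y) Q
        \<and> vscale c x + y \<in> V_compl M" ..
  qed
  then show ?thesis by blast
qed

lemma weight_vector_coordinate:
  assumes "v \<in> V_hat M" "\<rho> (ugen (Gen_h i)) v = vscale a v" "v Q \<noteq> 0"
  shows "eigenvalue Q i = a"
  using h_coordinate[OF assms(1), of i Q] assms(2,3) by (simp add: vscale_def)

lemma comm_shifts_weight: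
  assumes v: "v \<in> V_compl M" and h: "\<rho> (ugen (Gen_h i)) v = vscale a v"
    and c: "comm (hscale 1 (ugen (Gen_h i))) x = hscale c x"
  shows "\<rho> (ugen (Gen_h i)) (\<rho> x v) = vscale (a + c) (\<rho> x v)"
proof -
  have "\<rho> (comm (hscale 1 (ugen (Gen_h i))) x) v
      = \<rho> (ugen (Gen_h i)) (\<rho> x v) - vscale a (\<rho> x v)"
    using v by (simp add: comm_def diff_left mult_left hscale_left closed h scale)
  moreover have "\<rho> (hscale c x) v = vscale c (\<rho> x v)"
    using v by (rule hscale_left)
  ultimately show ?thesis
    using c by (simp add: hmod.scale_left_distrib algebra_simps)
qed

lemma hscale_1: "hscale 1 x = x"
  by transfer (simp add: rel_eq_def scal_of_int[of 1, simplified] rel_ideal_0)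

text \<open>Distinct weights live on disjoint sets of basis vectors, so in each coordinate of
  \<open>\<rho> x (ket M P)\<close> only the words of the weight of \<open>x\<close> can contribute.  Projecting in the module
  avoids decomposing \<open>x\<close> into weight components in the algebra.  The sign \<open>s\<close> is 1 for the \<open>e\<^sub>i\<close> and
  -1 for the \<open>f\<^sub>i\<close>.\<close>

lemma weight_element_kills_ket:
  assumes x: "x \<in> subalgebra_gen (range (\<lambda>i. ugen (g i)))"
    and wt_x: "\<forall>h'. comm (H_elem h') x = hscale (fps_const (of_int s * root_eval \<beta> h')) x"
    and wt_g: "\<And>i j. comm (ugen (Gen_h i)) (ugen (g j))
                = hscale (of_int (s * (kron i j - kron i (j + 1)))) (ugen (g j))"
    and s: "s \<noteq> 0"
    and inv: "\<And>i Q. Q \<in> C_patterns M \<Longrightarrow> \<rho> (ugen (g i)) (ket M Q) \<in> V_hat M"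
    and P: "P \<in> C_patterns M"
    and kill: "\<And>w. set w = Poly_Mapping.keys \<beta> \<Longrightarrow>
                 \<rho> (prod_list (map (\<lambda>i. ugen (g i)) w)) (ket M P) = 0"
  shows "\<rho> x (ket M P) = 0"
proof (rule ccontr)
  let ?g = "\<lambda>i. ugen (g i)"
  let ?v = "ket M P"
  assume "\<rho> x ?v \<noteq> 0"
  then obtain Q where Q: "\<rho> x ?v Q \<noteq> 0" by (auto simp: fun_eq_iff)
  have v: "?v \<in> V_compl M" by (rule ket_in_V_compl)
  have word: "\<rho> (prod_list (map ?g w)) ?v \<in> V_hat M" for w
  proof (induction w)
    case Nil
    show ?case using v by (simp add: one_left ket_in_V_hat)
  next
    case (Cons i w)
    have "\<rho> (?g i) (\<rho> (prod_list (map ?g w)) ?v) \<in> V_hat M"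
      by (rule span_into[OF _ _ _ Cons[unfolded V_hat_def]])
        (auto simp: ket_in_V_compl inv, simp add: V_hat_def)
    then show ?case using v by (simp add: mult_left)
  qed
  have word_h: "\<rho> (ugen (Gen_h i)) (\<rho> (prod_list (map ?g w)) ?v)
      = vscale (eigenvalue P i + of_int (s * (\<Sum>j\<leftarrow>w. kron i j - kron i (j + 1))))
          (\<rho> (prod_list (map ?g w)) ?v)" for w i
  proof (induction w)
    case Nil
    show ?case using v P by (simp add: one_left h_ket)
  next
    case (Cons j w)
    have "\<rho> (prod_list (map ?g w)) ?v \<in> V_compl M" using v by (rule closed)
    from comm_shifts_weight[OF this Cons, unfolded hscale_1, OF wt_g]
    have "\<rho> (ugen (Gen_h i)) (\<rho> (prod_list (map ?g (j # w))) ?v)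
      = vscale (eigenvalue P i + of_int (s * (\<Sum>j\<leftarrow>w. kron i j - kron i (j + 1)))
          + of_int (s * (kron i j - kron i (j + 1)))) (\<rho> (prod_list (map ?g (j # w))) ?v)"
      using v by (simp add: mult_left)
    moreover have "eigenvalue P i + of_int (s * (\<Sum>j\<leftarrow>w. kron i j - kron i (j + 1)))
          + of_int (s * (kron i j - kron i (j + 1)))
        = eigenvalue P i + of_int (s * (\<Sum>j\<leftarrow>j # w. kron i j - kron i (j + 1)))"
      by (simp add: algebra_simps)
    ultimately show ?case by (simp only:)
  qed
  have span: "\<rho> x ?v \<in> hmod.span {\<rho> (prod_list (map ?g w)) ?v |w. True}"
    using x v by (rule subalgebra_span_words)
  then have x_in: "\<rho> x ?v \<in> V_hat M"
    using word hmod.span_minimal[of _ "V_hat M"] unfolding V_hat_def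
    by (smt (verit, ccfv_threshold) hmod.subspace_span mem_Collect_eq subset_iff)
  from span Q obtain w where w: "\<rho> (prod_list (map ?g w)) ?v Q \<noteq> 0"
    by (auto elim: span_coordinate_nonzero)
  have "int (count_list w i) - int (count_list w (i - 1))
      = int (Poly_Mapping.lookup \<beta> i) - int (Poly_Mapping.lookup \<beta> (i - 1))" (is "?a = ?b") for i
  proof -
    have "comm (hscale 1 (ugen (Gen_h i))) x = hscale (of_int (s * ?b)) x"
      using wt_x[rule_format, of "Poly_Mapping.single i 1"]
      unfolding H_elem_single root_eval_single
      by (simp only: of_int_mult[symmetric] fps_of_int)
    from comm_shifts_weight[OF v h_ket[OF P] this]
    have "eigenvalue Q i = eigenvalue P i + of_int (s * ?b)"
      by (rule weight_vector_coordinate[OF x_in _ Q])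
    moreover have "eigenvalue Q i = eigenvalue P i + of_int (s * ?a)"
      using weight_vector_coordinate[OF word word_h w] by (simp only: sum_list_kron)
    ultimately have "of_int (s * ?a) = (of_int (s * ?b) :: complex fps)" by simp
    then have "fps_nth (fps_const (of_int (s * ?a)) :: complex fps) 0
        = fps_nth (fps_const (of_int (s * ?b))) 0"
      by (simp only: fps_of_int)
    then have "s * ?a = s * ?b" by (simp only: fps_nth_fps_const of_int_eq_iff simp_thms if_True)
    with s show ?thesis by simp
  qed
  then have "count_list w = Poly_Mapping.lookup \<beta>"
  proof (rule finite_support_eq_if_differences_eq)
    show "finite {i. count_list w i \<noteq> 0}"
      by (rule finite_subset[of _ "set w"]) (auto simp: count_list_0_iff)
  qed simp
  then have "set w = Poly_Mapping.keys \<beta>"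
    by (metis (no_types, lifting) count_list_0_iff in_keys_iff subsetI subset_antisym)
  with kill w show False by simp
qed

end


section \<open>Interlacing obstructions\<close>

lemma minus_one_not_Nats: "(- 1 :: complex poly) \<notin> \<nat>"
proof
  assume "(- 1 :: complex poly) \<in> \<nat>"
  then obtain k where "(- 1 :: complex poly) = of_nat k" by (auto simp: Nats_def)
  then have "(of_nat (Suc k) :: complex poly) = 0" by (simp flip: \<open>- 1 = of_nat k\<close>)
  then show False by (simp only: of_nat_eq_0_iff)
qed

lemma interlace:
  assumes "P \<in> C_patterns M" "k \<ge> 1"
  shows "i \<in> {1 - k .. k - 1} \<Longrightarrow> P (i - 1) (2 * k) - P i (2 * k - 1) \<in> \<nat>"
    and "i \<in> {1 - k .. k - 1} \<Longrightarrow> P i (2 * k - 1) - P i (2 * k) \<in> \<nat>"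
    and "i \<in> {- k .. k - 1} \<Longrightarrow> P i (2 * k + 1) - P i (2 * k) \<in> \<nat>"
    and "i \<in> {- k .. k - 1} \<Longrightarrow> P i (2 * k) - P (i + 1) (2 * k + 1) \<in> \<nat>"
proof -
  have *: "\<forall>t\<in>{0, 1}. \<forall>i\<in>{1 - t - k .. k - 1}.
          P (i + t - 1) (2 * k + t) - P i (2 * k + t - 1) \<in> \<nat>
        \<and> P i (2 * k + t - 1) - P (i + t) (2 * k + t) \<in> \<nat>"
    using assms unfolding C_patterns_def by blast
  show "i \<in> {1 - k .. k - 1} \<Longrightarrow> P (i - 1) (2 * k) - P i (2 * k - 1) \<in> \<nat>"
    and "i \<in> {1 - k .. k - 1} \<Longrightarrow> P i (2 * k - 1) - P i (2 * k) \<in> \<nat>"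
    using *[rule_format, of 0 i] by simp_all
  show "i \<in> {- k .. k - 1} \<Longrightarrow> P i (2 * k + 1) - P i (2 * k) \<in> \<nat>"
    and "i \<in> {- k .. k - 1} \<Longrightarrow> P i (2 * k) - P (i + 1) (2 * k + 1) \<in> \<nat>"
    using *[rule_format, of 1 i] by simp_all
qed

lemma stable_rows:
  assumes "stable_from M N P" "k \<ge> 1"
  shows "2 * k - 1 \<ge> N \<Longrightarrow> i \<in> {1 - k .. k - 1} \<Longrightarrow> P i (2 * k - 1) = M i"
    and "2 * k \<ge> N \<Longrightarrow> i \<in> {- k .. k - 1} \<Longrightarrow> P i (2 * k) = M i"
proof -
  have *: "\<forall>t\<in>{0, 1}. 2 * k + t - 1 \<ge> N \<longrightarrow>
      (\<forall>i\<in>{1 - t - k .. k - 1}. P i (2 * k + t - 1) = M i)"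
    using assms unfolding stable_from_def by blast
  show "2 * k - 1 \<ge> N \<Longrightarrow> i \<in> {1 - k .. k - 1} \<Longrightarrow> P i (2 * k - 1) = M i"
    using *[rule_format, of 0 i] by simp
  show "2 * k \<ge> N \<Longrightarrow> i \<in> {- k .. k - 1} \<Longrightarrow> P i (2 * k) = M i"
    using *[rule_format, of 1 i] by simp
qed

lemma stable_from_bump: "stable_from M N P \<Longrightarrow> p < N \<Longrightarrow> stable_from M N (bump P s j p)"
  unfolding stable_from_def bump_def by force

text \<open>The entry in column \<open>l\<close> of an even row is bounded above by the entry in column \<open>l\<close> of the
  next row; once both rows are stable these entries are equal, so raising is impossible.\<close>

lemma raise_not_pattern:
  assumes "stable_from M N P" "k \<ge> 1" "2 * k \<ge> N" "l \<in> {- k .. k - 1}"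
  shows "bump (bump P s j (2 * k - 1)) 1 l (2 * k) \<notin> C_patterns M" (is "?Q \<notin> _")
proof
  assume "?Q \<in> C_patterns M"
  from interlace(3)[OF this assms(2,4)]
  have "P l (2 * (k + 1) - 1) - (P l (2 * k) + 1) \<in> \<nat>" by (simp add: bump_def algebra_simps)
  moreover have "P l (2 * (k + 1) - 1) = M l"
    using assms by (intro stable_rows(1)[OF assms(1)]) auto
  moreover have "P l (2 * k) = M l"
    using assms by (intro stable_rows(2)[OF assms(1)]) auto
  ultimately show False using minus_one_not_Nats by simp
qed

text \<open>The same from an odd row to the next even one, where the bound in column \<open>l\<close> is from below.\<close>

lemma lower_not_pattern:
  assumes "stable_from M N P" "k \<ge> 1" "2 * k + 1 \<ge> N" "l \<in> {- k .. k}"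
  shows "bump (bump P s j (2 * k)) (- 1) l (2 * k + 1) \<notin> C_patterns M" (is "?Q \<notin> _")
proof
  assume Q: "?Q \<in> C_patterns M"
  have "?Q l (2 * (k + 1) - 1) - ?Q l (2 * (k + 1)) \<in> \<nat>"
    using assms by (intro interlace(2)[OF Q]) auto
  then have "(P l (2 * (k + 1) - 1) - 1) - P l (2 * (k + 1)) \<in> \<nat>"
    by (simp add: bump_def algebra_simps)
  moreover have "P l (2 * (k + 1) - 1) = M l"
    using assms by (intro stable_rows(1)[OF assms(1)]) auto
  moreover have "P l (2 * (k + 1)) = M l"
    using assms by (intro stable_rows(2)[OF assms(1)]) auto
  ultimately show False using minus_one_not_Nats by simp
qed

text \<open>Two adjacent rows \<open>2 * k - 1\<close> and \<open>2 * k\<close> can only be lowered in the same column, since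
  otherwise they no longer interlace.  Row \<open>2 * k - 2\<close> bounds row \<open>2 * k - 1\<close> from below, with
  equality, in every column but the last one, \<open>k - 1\<close>.  There row \<open>2 * k\<close> is bounded from below by
  the entry \<open>M k\<close> of row \<open>2 * k + 1\<close>, again with equality because \<open>M (k - 1) = M k\<close>.\<close>

lemma lower2_not_pattern:
  assumes st: "stable_from M N P" and k: "k \<ge> 2" "2 * k - 2 \<ge> N" and M: "M (k - 1) = M k"
    and j: "j \<in> {1 - k .. k - 1}" and l: "l \<in> {- k .. k - 1}"
  shows "bump (bump P (- 1) j (2 * k - 1)) (- 1) l (2 * k) \<notin> C_patterns M" (is "?Q \<notin> _")
proof
  assume Q: "?Q \<in> C_patterns M"
  have rows: "P j (2 * k - 1) = M j" "P i (2 * k) = M i" if "i \<in> {- k .. k - 1}" for i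
    using that j k stable_rows(1)[OF st, of k j] stable_rows(2)[OF st, of k i] by auto
  have "?Q j (2 * k - 1) - ?Q j (2 * k) \<in> \<nat>"
    using k j by (intro interlace(2)[OF Q]) auto
  then have lj: "l = j"
    using rows[of j] j minus_one_not_Nats by (auto simp: bump_def split: if_splits)
  show False
  proof (cases "j = k - 1")
    case True
    have "?Q j (2 * k) - ?Q (j + 1) (2 * k + 1) \<in> \<nat>"
      using k l lj by (intro interlace(4)[OF Q]) auto
    moreover have "P k (2 * (k + 1) - 1) = M k"
      using k by (intro stable_rows(1)[OF st]) auto
    ultimately show False
      using rows[of j] l lj True M minus_one_not_Nats by (simp add: bump_def algebra_simps)
  next
    case False
    have "?Q j (2 * (k - 1) + 1) - ?Q j (2 * (k - 1)) \<in> \<nat>"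
      using k j False by (intro interlace(3)[OF Q]) auto
    moreover have "P j (2 * (k - 1)) = M j"
      using k j False by (intro stable_rows(2)[OF st]) auto
    ultimately show False
      using rows[of j] l lj minus_one_not_Nats by (simp add: bump_def algebra_simps)
  qed
qed

text \<open>The mirror image: row \<open>2 * k - 1\<close> blocks every column but the first one, \<open>- k\<close>, and there
  the entry \<open>M (- k - 1)\<close> of row \<open>2 * k + 2\<close> does.\<close>

lemma raise2_not_pattern:
  assumes st: "stable_from M N P" and k: "k \<ge> 2" "2 * k - 1 \<ge> N" and M: "M (- k) = M (- k - 1)"
    and j: "j \<in> {- k .. k - 1}" and l: "l \<in> {- k .. k}"
  shows "bump (bump P 1 j (2 * k)) 1 l (2 * k + 1) \<notin> C_patterns M" (is "?Q \<notin> _")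
proof
  assume Q: "?Q \<in> C_patterns M"
  have rows: "P j (2 * k) = M j" "P i (2 * k + 1) = M i" if "i \<in> {- k .. k}" for i
    using that j k stable_rows(1)[OF st, of "k + 1" i] stable_rows(2)[OF st, of k j]
    by (auto simp: algebra_simps)
  have "?Q j (2 * k + 1) - ?Q j (2 * k) \<in> \<nat>"
    using k j by (intro interlace(3)[OF Q]) auto
  then have lj: "l = j"
    using rows[of j] j minus_one_not_Nats by (auto simp: bump_def split: if_splits)
  show False
  proof (cases "j = - k")
    case True
    have "?Q (j - 1) (2 * (k + 1)) - ?Q j (2 * (k + 1) - 1) \<in> \<nat>"
      using k l lj by (intro interlace(1)[OF Q]) auto
    moreover have "P (- k - 1) (2 * (k + 1)) = M (- k - 1)"
      using k by (intro stable_rows(2)[OF st]) auto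
    ultimately show False
      using rows[of j] l lj True M minus_one_not_Nats by (simp add: bump_def algebra_simps)
  next
    case False
    have "?Q j (2 * k - 1) - ?Q j (2 * k) \<in> \<nat>"
      using k j False by (intro interlace(2)[OF Q]) auto
    moreover have "P j (2 * k - 1) = M j"
      using k j False by (intro stable_rows(1)[OF st]) auto
    ultimately show False
      using rows[of j] l lj minus_one_not_Nats by (simp add: bump_def algebra_simps)
  qed
qed


section \<open>The action of the generators\<close>

lemma ket_eq_0: "P \<notin> C_patterns M \<Longrightarrow> ket M P = 0"
  by (auto simp: ket_def)

lemma ket_in_V_sub: "(P \<in> C_patterns M \<Longrightarrow> stable_from M N P) \<Longrightarrow> ket M P \<in> V_sub M N"
  by (cases "P \<in> C_patterns M")
    (auto simp: V_sub_def ket_eq_0 hmod.span_zero intro!: hmod.span_base)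

lemma int_cases_sign:
  fixes s :: int
  obtains (nonneg) k where "k \<ge> 1" "s = k - 1" | (minus_one) "s = - 1"
    | (neg) k where "k \<ge> 1" "s = - k - 1"
proof -
  consider "s \<ge> 0" | "s = - 1" | "s \<le> - 2" by linarith
  then show thesis
    using that(1)[of "s + 1"] that(2) that(3)[of "- s - 1"] by cases simp_all
qed

context pattern_rep
begin

text \<open>The image of a basis vector is a combination of the kets of the shifted arrays, so every
  statement "the image lies in \<open>S\<close>" reduces to these kets.  Here \<open>S\<close> will be \<^term>\<open>V_hat M\<close>,
  \<^term>\<open>V_sub M N\<close> or \<open>{0}\<close>.  The direction of the shift for \<open>s \<ge> 0\<close> is \<open>\<epsilon>\<close>; it is reversed for
  negative \<open>s\<close>.\<close>

lemma action_into:
  assumes g: "g = Gen_e \<and> \<epsilon> = 1 \<or> g = Gen_f \<and> \<epsilon> = - 1"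
    and P: "P \<in> C_patterns M" and S: "hmod.subspace S"
    and nonneg: "\<And>k j l. k \<ge> 1 \<Longrightarrow> s = k - 1 \<Longrightarrow> j \<in> {1 - k .. k - 1} \<Longrightarrow> l \<in> {- k .. k - 1} \<Longrightarrow>
       ket M (bump (bump P \<epsilon> j (2 * k - 1)) \<epsilon> l (2 * k)) \<in> S"
    and minus_one: "s = - 1 \<Longrightarrow> ket M (bump P (- \<epsilon>) 0 1) \<in> S"
    and neg: "\<And>k j l. k \<ge> 1 \<Longrightarrow> s = - k - 1 \<Longrightarrow> j \<in> {- k .. k - 1} \<Longrightarrow> l \<in> {- k .. k} \<Longrightarrow>
       ket M (bump (bump P (- \<epsilon>) j (2 * k)) (- \<epsilon>) l (2 * k + 1)) \<in> S"
  shows "\<rho> (ugen (g s)) (ket M P) \<in> S"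
proof -
  define \<mu> :: nat where "\<mu> = (if \<epsilon> = 1 then 1 else 0)"
  have \<mu>: "\<mu> \<in> {0, 1}" "ugen (g s) = egen \<mu> s" "- ((- 1) ^ \<mu>) = \<epsilon>"
    "1 - \<mu> \<in> {0, 1}" "1 - (1 - \<mu>) = \<mu>" "- ((- 1) ^ (1 - \<mu>)) = - \<epsilon>" "(- 1) ^ \<mu> = - \<epsilon>"
    using g by (auto simp: \<mu>_def egen_def)
  have one: "\<rho> (egen (1 - \<mu>') (- 1)) (ket M P) =
          vscale (pos_sqrt (qbracket (Ldiff P (- 1) 2 0 1 - int \<mu>')
                          * qbracket (Ldiff P 0 1 0 2 + int \<mu>')))
            (ket M (bump P (- ((- 1) ^ \<mu>')) 0 1))" if "\<mu>' \<in> {0, 1}" for \<mu>'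
    using pattern_rep P that unfolding is_pattern_rep_def by blast
  have gen: "\<rho> (egen \<mu> ((- 1) ^ \<nu> * i - 1)) (ket M P) \<in> S"
    if "i \<ge> 1" "\<nu> \<in> {0, 1}"
      and kets: "\<And>j l. j \<in> {1 - i - int \<nu> .. i - 1} \<Longrightarrow> l \<in> {- i .. i + int \<nu> - 1} \<Longrightarrow>
        ket M (bump (bump P (- ((- 1) ^ (\<mu> + \<nu>))) j (2 * i + int \<nu> - 1))
                (- ((- 1) ^ (\<mu> + \<nu>))) l (2 * i + int \<nu>)) \<in> S" for i \<nu>
  proof -
    have "\<rho> (egen \<mu> ((- 1) ^ \<nu> * i - 1)) (ket M P) =
          - (\<Sum>j\<in>{1 - i - int \<nu> .. i - 1}. \<Sum>l\<in>{- i .. i + int \<nu> - 1}.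
              vscale (Ssign j l \<nu> * pos_sqrt (absX P i \<mu> \<nu> j l * absY P i \<mu> \<nu> j l))
                (ket M (bump (bump P (- ((- 1) ^ (\<mu> + \<nu>))) j (2 * i + int \<nu> - 1))
                          (- ((- 1) ^ (\<mu> + \<nu>))) l (2 * i + int \<nu>))))"
      using pattern_rep P that(1,2) \<mu>(1) unfolding is_pattern_rep_def by blast
    also have "\<dots> \<in> S"
      by (intro hmod.subspace_neg hmod.subspace_sum hmod.subspace_scale S kets)
    finally show ?thesis .
  qed
  show ?thesis
  proof (cases s rule: int_cases_sign)
    case (nonneg k)
    have "\<rho> (egen \<mu> ((- 1) ^ 0 * k - 1)) (ket M P) \<in> S"
      using nonneg by (intro gen) (simp_all add: \<mu>(3) assms(4))
    then show ?thesis unfolding \<mu>(2) using nonneg by simp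
  next
    case minus_one
    have "\<rho> (egen (1 - (1 - \<mu>)) (- 1)) (ket M P) \<in> S"
      unfolding one[OF \<mu>(4)] \<mu>(6) by (intro hmod.subspace_scale S assms(5) minus_one)
    then show ?thesis unfolding \<mu>(2,5) using minus_one by simp
  next
    case (neg k)
    have "\<rho> (egen \<mu> ((- 1) ^ 1 * k - 1)) (ket M P) \<in> S"
      using neg by (intro gen) (simp_all add: \<mu>(7) assms(6))
    then show ?thesis unfolding \<mu>(2) using neg by simp
  qed
qed

lemma kills_V_sub:
  assumes "\<And>P. P \<in> C_patterns M \<Longrightarrow> stable_from M N P \<Longrightarrow> \<rho> x (ket M P) = 0" "v \<in> V_sub M N"
  shows "\<rho> x v = 0"
proof -
  have "\<rho> x v \<in> {0}"
    by (rule span_into[OF _ _ _ assms(2)[unfolded V_sub_def]])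
      (use assms(1) in \<open>auto simp: ket_in_V_compl\<close>)
  then show ?thesis by simp
qed

lemma e_V_hat: "P \<in> C_patterns M \<Longrightarrow> \<rho> (ugen (Gen_e s)) (ket M P) \<in> V_hat M"
  by (rule action_into[of Gen_e 1]) (auto simp: ket_in_V_hat, simp add: V_hat_def)

lemma f_V_hat: "P \<in> C_patterns M \<Longrightarrow> \<rho> (ugen (Gen_f s)) (ket M P) \<in> V_hat M"
  by (rule action_into[of Gen_f "- 1"]) (auto simp: ket_in_V_hat, simp add: V_hat_def)

text \<open>A shift in a row below \<open>N\<close> keeps the array stable from \<open>N\<close>; one whose upper row is at
  least \<open>N\<close> runs into the next row.\<close>

lemma e_V_sub:
  assumes "N > 1" "v \<in> V_sub M N"
  shows "\<rho> (ugen (Gen_e s)) v \<in> V_sub M N"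
proof (rule span_into[OF _ _ _ assms(2)[unfolded V_sub_def]])
  show sub: "hmod.subspace (V_sub M N)" by (simp add: V_sub_def)
  fix b assume "b \<in> {ket M P |P. P \<in> C_patterns M \<and> stable_from M N P}"
  then obtain P where P: "P \<in> C_patterns M" "stable_from M N P" and b: "b = ket M P" by blast
  show "\<rho> (ugen (Gen_e s)) b \<in> V_sub M N"
    unfolding b
  proof (rule action_into[of Gen_e 1, OF _ P(1) sub])
    fix k j l :: int
    assume kl: "k \<ge> 1" "l \<in> {- k .. k - 1}"
    show "ket M (bump (bump P 1 j (2 * k - 1)) 1 l (2 * k)) \<in> V_sub M N"
    proof (rule ket_in_V_sub, cases "2 * k < N")
      case True
      then show "stable_from M N (bump (bump P 1 j (2 * k - 1)) 1 l (2 * k))"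
        by (intro stable_from_bump P) auto
    qed (use raise_not_pattern[OF P(2) kl(1) _ kl(2)] in auto)
  next
    show "ket M (bump P (- 1) 0 1) \<in> V_sub M N"
      using assms(1) by (intro ket_in_V_sub stable_from_bump P)
  next
    fix k j l :: int
    assume kl: "k \<ge> 1" "l \<in> {- k .. k}"
    show "ket M (bump (bump P (- 1) j (2 * k)) (- 1) l (2 * k + 1)) \<in> V_sub M N"
    proof (rule ket_in_V_sub, cases "2 * k + 1 < N")
      case True
      then show "stable_from M N (bump (bump P (- 1) j (2 * k)) (- 1) l (2 * k + 1))"
        by (intro stable_from_bump P) auto
    qed (use lower_not_pattern[OF P(2) kl(1) _ kl(2)] in auto)
  qed simp
qed (auto simp: ket_in_V_compl)

text \<open>For far \<open>s\<close> only the second alternative of \<open>e_V_sub\<close> remains.\<close>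

lemma far_e_kills:
  assumes "2 * \<bar>s\<bar> \<ge> N + 3" "N > 1" "v \<in> V_sub M N"
  shows "\<rho> (ugen (Gen_e s)) v = 0"
proof (rule kills_V_sub[OF _ assms(3)])
  fix P assume P: "P \<in> C_patterns M" "stable_from M N P"
  have "\<rho> (ugen (Gen_e s)) (ket M P) \<in> {0}"
    using assms(1,2)
    by (intro action_into[of Gen_e 1, OF _ P(1)])
      (auto simp: ket_eq_0 raise_not_pattern[OF P(2)] lower_not_pattern[OF P(2)])
  then show "\<rho> (ugen (Gen_e s)) (ket M P) = 0" by simp
qed

lemma far_f_kills:
  assumes P: "P \<in> C_patterns M" "stable_from M N P"
    and far: "2 * \<bar>s\<bar> \<ge> N + 3" "N > 1"
    and M: "s \<ge> 0 \<Longrightarrow> M s = M (s + 1)" "s < 0 \<Longrightarrow> M (s + 1) = M s"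
  shows "\<rho> (ugen (Gen_f s)) (ket M P) = 0"
proof -
  have "\<rho> (ugen (Gen_f s)) (ket M P) \<in> {0}"
    using far M
    by (intro action_into[of Gen_f "- 1", OF _ P(1)])
      (auto simp: ket_eq_0 lower2_not_pattern[OF P(2)] raise2_not_pattern[OF P(2)])
  then show ?thesis by simp
qed

lemma e_word_with_far_letter_kills:
  assumes "N > 1" "v \<in> V_sub M N" "s \<in> set w" "2 * \<bar>s\<bar> \<ge> N + 3"
  shows "\<rho> (prod_list (map (\<lambda>i. ugen (Gen_e i)) w)) v = 0"
proof -
  let ?w = "\<lambda>w. prod_list (map (\<lambda>i. ugen (Gen_e i)) w)"
  have v: "v \<in> V_compl M" using assms(2) V_sub_subset_V_compl by blast
  have inv: "\<rho> (?w w') v \<in> V_sub M N" for w'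
    by (induction w') (use assms v in \<open>auto simp: one_left mult_left e_V_sub\<close>)
  \<comment> \<open>The letters to the right of \<open>s\<close> act first and do not leave \<^term>\<open>V_sub M N\<close>.\<close>
  from split_list[OF assms(3)] obtain w1 w2 where w: "w = w1 @ s # w2" by blast
  show ?thesis
    using v far_e_kills[OF assms(4,1) inv] by (simp add: w mult_left closed zero)
qed

end


section \<open>The eigenvalues of \<open>h\<^sub>i\<close>\<close>

text \<open>The longer of the two stable rows exceeds the shorter one by exactly the entry \<open>M i\<close>, in
  its last column for \<open>i \<ge> 0\<close> and in its first one for \<open>i < 0\<close>.\<close>

lemma h_eigenvalue_far:
  assumes st: "stable_from M N P" and far: "2 * \<bar>i\<bar> \<ge> N + 3" "N > 1"
    and M: "i \<ge> 0 \<Longrightarrow> M i = \<xi>\<^sub>1" "i < 0 \<Longrightarrow> M i = \<xi>\<^sub>0"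
  shows "h_eigenvalue \<xi>\<^sub>0 \<xi>\<^sub>1 P i = 0"
proof (cases "i \<ge> 0")
  case True
  have a: "(\<Sum>j\<in>{- i .. i}. P j (2 * i + 1)) = (\<Sum>j\<in>{- i .. i}. M j)"
    using stable_rows(1)[OF st, of "i + 1"] far True
    by (intro sum.cong) (auto simp: add.commute)
  have b: "(\<Sum>j\<in>{- i .. i - 1}. P j (2 * i)) = (\<Sum>j\<in>{- i .. i - 1}. M j)"
    using stable_rows(2)[OF st, of i] far True by (intro sum.cong) auto
  have "{- i .. i} = insert i {- i .. i - 1}" using True by auto
  then have "(\<Sum>j\<in>{- i .. i}. M j) = M i + (\<Sum>j\<in>{- i .. i - 1}. M j)" by simp
  with a b show ?thesis
    using True far M(1) by (simp add: h_eigenvalue_def theta_def)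
next
  case False
  define k where "k = - i"
  have k: "k \<ge> 2" "2 * k \<ge> N + 3" "i = - k" using False far by (auto simp: k_def)
  have a: "(\<Sum>j\<in>{- k .. k - 1}. P j (2 * k)) = (\<Sum>j\<in>{- k .. k - 1}. M j)"
    using stable_rows(2)[OF st, of k] k by (intro sum.cong) auto
  have b: "(\<Sum>j\<in>{- k + 1 .. k - 1}. P j (2 * k - 1)) = (\<Sum>j\<in>{- k + 1 .. k - 1}. M j)"
    using stable_rows(1)[OF st, of k] k by (intro sum.cong) auto
  have "{- k .. k - 1} = insert (- k) {- k + 1 .. k - 1}" using k by auto
  then have "(\<Sum>j\<in>{- k .. k - 1}. M j) = M (- k) + (\<Sum>j\<in>{- k + 1 .. k - 1}. M j)" by simp
  with a b show ?thesis
    using k M(2) by (simp add: h_eigenvalue_def theta_def)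
qed

theorem mainTheorem4:
  fixes m n :: int and M :: "int \<Rightarrow> complex poly"
    and \<rho> :: "uha \<Rightarrow> vec \<Rightarrow> vec" and v :: vec and vs :: "nat \<Rightarrow> vec"
  assumes "m \<le> n"
    and "\<forall>i j. i < j \<longrightarrow> M i - M j \<in> \<nat>"
    and "\<forall>k\<ge>1. M (m - k) = M m"
    and "\<forall>k\<ge>1. M (n + k) = M n"
    and "is_pattern_rep M (M m) (M n) \<rho>"
    and "v \<in> V_compl M"
    and "\<forall>k. vs k \<in> V_hat M"
    and "hadic_sums M (\<lambda>k. vscale (fps_X ^ k) (vs k)) v"
  shows "\<forall>k. \<exists>N::int. N > 1 \<and> vs k \<in> V_sub M N \<and>
    (let r = Max {(of_int N + 3) / 2, 1 - of_int m, of_int n} :: real in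
        (\<forall>\<beta>. \<not> Poly_Mapping.keys \<beta> \<subseteq> {i. - r < of_int i \<and> of_int i < r} \<longrightarrow>
            (\<forall>x\<in>U_plus_weight \<beta>. \<rho> x (vs k) = 0))
      \<and> (\<forall>\<alpha>. \<alpha> \<noteq> 0 \<and>
              (Poly_Mapping.keys \<alpha> \<subseteq> {i. of_int i \<le> - r} \<or>
               Poly_Mapping.keys \<alpha> \<subseteq> {i. r \<le> of_int i}) \<longrightarrow>
            (\<forall>x\<in>U_minus_weight \<alpha>. \<rho> x (vs k) = 0))
      \<and> (\<forall>i::int. r \<le> of_int \<bar>i\<bar> \<longrightarrow> \<rho> (ugen (Gen_h i)) (vs k) = 0))"
proof
  fix k
  interpret pattern_rep M \<rho> "M m" "M n"
    using assms(5) by unfold_locales (auto simp: is_pattern_rep_def)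
  from assms(7) V_hat_exhausted_by_V_sub obtain N where N: "N > 1" "vs k \<in> V_sub M N" by blast
  define r where "r = Max {(of_int N + 3) / 2, 1 - of_int m, of_int n :: real}"
  have far: "2 * \<bar>i\<bar> \<ge> N + 3" "\<bar>i\<bar> \<ge> 1 - m" "\<bar>i\<bar> \<ge> n" if "r \<le> of_int \<bar>i\<bar>" for i :: int
    using that by (auto simp: r_def)
  have M_right: "M i = M n" if "i \<ge> n" for i
    using that assms(4)[rule_format, of "i - n"] by (cases "i = n") auto
  have M_left: "M i = M m" if "i \<le> m" for i
    using that assms(3)[rule_format, of "m - i"] by (cases "i = m") auto
  have 1: "\<rho> x (vs k) = 0"
    if keys: "\<not> Poly_Mapping.keys \<beta> \<subseteq> {i. - r < of_int i \<and> of_int i < r}"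
      and x: "x \<in> U_plus_weight \<beta>" for \<beta> x
  proof (rule kills_V_sub[OF _ N(2)])
    from keys obtain s where s: "s \<in> Poly_Mapping.keys \<beta>" "\<not> (- r < of_int s \<and> of_int s < r)"
      by blast
    then have s_far: "r \<le> of_int \<bar>s\<bar>" by (auto simp: not_less of_int_abs)
    from s(1) have "\<beta> \<noteq> 0" by auto
    with x have x: "x \<in> U_plus" "\<forall>h'. comm (H_elem h') x = hscale (fps_const (root_eval \<beta> h')) x"
      by (auto simp: U_plus_weight_def)
    fix P assume P: "P \<in> C_patterns M" "stable_from M N P"
    have P_in: "ket M P \<in> V_sub M N" using P by (intro ket_in_V_sub)
    show "\<rho> x (ket M P) = 0"
    proof (rule weight_element_kills_ket[where g = Gen_e and s = 1 and \<beta> = \<beta>])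
      fix w assume "set w = Poly_Mapping.keys \<beta>"
      with s(1) far(1)[OF s_far] show "\<rho> (prod_list (map (\<lambda>i. ugen (Gen_e i)) w)) (ket M P) = 0"
        by (intro e_word_with_far_letter_kills[OF N(1) P_in]) auto
    qed (use x P in \<open>simp_all add: U_plus_def comm_h_e e_V_hat\<close>)
  qed
  have 2: "\<rho> x (vs k) = 0"
    if "\<alpha> \<noteq> 0" and keys: "Poly_Mapping.keys \<alpha> \<subseteq> {i. of_int i \<le> - r} \<or>
          Poly_Mapping.keys \<alpha> \<subseteq> {i. r \<le> of_int i}"
      and x: "x \<in> U_minus_weight \<alpha>" for \<alpha> x
  proof (rule kills_V_sub[OF _ N(2)])
    have far_key: "r \<le> of_int \<bar>i\<bar>" if "i \<in> Poly_Mapping.keys \<alpha>" for i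
      using keys that by fastforce
    have x: "x \<in> U_minus" "\<forall>h'. comm (H_elem h') x = hscale (fps_const (- root_eval \<alpha> h')) x"
      using x \<open>\<alpha> \<noteq> 0\<close> by (auto simp: U_minus_weight_def)
    fix P assume P: "P \<in> C_patterns M" "stable_from M N P"
    show "\<rho> x (ket M P) = 0"
    proof (rule weight_element_kills_ket[where g = Gen_f and s = "- 1" and \<beta> = \<alpha>])
      fix w assume w: "set w = Poly_Mapping.keys \<alpha>"
      with \<open>\<alpha> \<noteq> 0\<close> have "w \<noteq> []" by (metis keys_eq_empty list.set(1))
      then obtain w' i where w': "w = w' @ [i]" by (metis rev_exhaust)
      with w far_key have "r \<le> of_int \<bar>i\<bar>" by auto
      note i = far[OF this]
      \<comment> \<open>Already the rightmost letter kills, as it acts on a pattern that is stable from \<open>N\<close>.\<close>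
      have "\<rho> (ugen (Gen_f i)) (ket M P) = 0"
      proof (rule far_f_kills[OF P i(1) N(1)])
        show "M i = M (i + 1)" if "i \<ge> 0"
          using that i M_right[of i] M_right[of "i + 1"] by simp
        show "M (i + 1) = M i" if "i < 0"
          using that i M_left[of i] M_left[of "i + 1"] by simp
      qed
      then show "\<rho> (prod_list (map (\<lambda>i. ugen (Gen_f i)) w)) (ket M P) = 0"
        by (simp add: w' mult_left ket_in_V_compl zero)
    qed (use x P in \<open>simp_all add: U_minus_def comm_h_f[simplified] f_V_hat\<close>)
  qed
  have 3: "\<rho> (ugen (Gen_h i)) (vs k) = 0" if "r \<le> of_int \<bar>i\<bar>" for i
  proof (rule kills_V_sub[OF _ N(2)])
    note i = far[OF that]
    fix P assume P: "P \<in> C_patterns M" "stable_from M N P"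
    have "h_eigenvalue (M m) (M n) P i = 0"
      using i by (intro h_eigenvalue_far[OF P(2) i(1) N(1)]) (auto intro!: M_left M_right)
    then show "\<rho> (ugen (Gen_h i)) (ket M P) = 0"
      by (simp add: h_ket[OF P(1)])
  qed
  show "\<exists>N::int. N > 1 \<and> vs k \<in> V_sub M N \<and>
    (let r = Max {(of_int N + 3) / 2, 1 - of_int m, of_int n} :: real in
        (\<forall>\<beta>. \<not> Poly_Mapping.keys \<beta> \<subseteq> {i. - r < of_int i \<and> of_int i < r} \<longrightarrow>
            (\<forall>x\<in>U_plus_weight \<beta>. \<rho> x (vs k) = 0))
      \<and> (\<forall>\<alpha>. \<alpha> \<noteq> 0 \<and>
              (Poly_Mapping.keys \<alpha> \<subseteq> {i. of_int i \<le> - r} \<or>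
               Poly_Mapping.keys \<alpha> \<subseteq> {i. r \<le> of_int i}) \<longrightarrow>
            (\<forall>x\<in>U_minus_weight \<alpha>. \<rho> x (vs k) = 0))
      \<and> (\<forall>i::int. r \<le> of_int \<bar>i\<bar> \<longrightarrow> \<rho> (ugen (Gen_h i)) (vs k) = 0))"
    using N 1 2 3 unfolding Let_def r_def by (intro exI[of _ N]) blast
qed

end
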